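(* Consider a two-asset AMM satisfying validity invariance, Pareto efficiency, and unit invariance, and additionally token relabeling symmetry: with $\tau(x,y)=(y,x)$, for all valid states $s,t\in\mathcal S$, $s\sim t\iff\tau(s)\sim\tau(t)$. Let $w\in(0,1)$ be such that the trading orbits in $\mathcal S$ are exactly the level sets of $x^wy^{1-w}$ (such a $w$ exists under validity invariance, Pareto efficiency, and unit invariance). Then $w=\tfrac12$ and $xy$ is constant on every trading orbit.
   Context: A state is a pair $s=(x,y)\in\mathbb R^2$; the valid state space is $\mathcal S=\{(x,y)\in\mathbb R^2: x>0,\ y>0\}$. A two-asset AMM consists of two swap primitives $X,Y:\mathbb R^2\times[0,\infty)\to\mathbb R^2$ of the form $X((x,y),dx)=(x+dx,\;y-y_{\mathrm{out}}((x,y),dx))$ and $Y((x,y),dy)=(x-x_{\mathrm{out}}((x,y),dy),\;y+dy)$, where $x_{\mathrm{out}},y_{\mathrm{out}}:\mathbb R^2\times[0,\infty)\to\mathbb R$ are arbitrary functions. Adjacency: $s\leftrightarrow t$ if there is $\delta\ge 0$ with $t=X(s,\delta)$ or $t=Y(s,\delta)$ or $s=X(t,\delta)$ or $s=Y(t,\delta)$. Orbit relation: $s\sim t$ if there is a finite chain of states (in $\mathbb R^2$) $s=s_0,s_1,\dots,s_n=t$ ($n\ge 0$) with $s_{i-1}\leftrightarrow s_i$ for all $i$. The trading orbit of $s\in\mathcal S$ is $[s]=\{t\in\mathcal S: t\sim s\}$. Validity invariance: for every $s\in\mathbb R^2$ and all $dx,dy\ge0$, $X(s,dx)\in\mathcal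 S\iff s\in\mathcal S$ and $Y(s,dy)\in\mathcal S\iff s\in\mathcal S$. Pareto efficiency: write $t\succeq s$ if both coordinates of $t$ are $\ge$ those of $s$. For all $s,t\in\mathcal S$, if $s\sim t$ and $t\succeq s$, then $t=s$. Unit invariance: with $T_{a,b}(x,y)=(ax,by)$, for all $a,b>0$, $s\in\mathcal S$, $dx,dy\ge0$: $X(T_{a,b}s,a\,dx)=T_{a,b}X(s,dx)$ and $Y(T_{a,b}s,b\,dy)=T_{a,b}Y(s,dy)$. *)

theory Defs
  imports Complex_Main
begin

type_synonym state = "real \<times> real"

definition valid_states :: "state set" where
  "valid_states = {(x, y). x > 0 \<and> y > 0}"

text \<open>A swap primitive has domain \<open>\<real>\<^sup>2 \<times> [0, \<infinity>)\<close>. It is represented by a total function whose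
  values at negative amounts are never used: every condition below only concerns
  nonnegative amounts.\<close>

type_synonym swap_primitive = "state \<Rightarrow> real \<Rightarrow> state"

definition two_asset_amm :: "swap_primitive \<Rightarrow> swap_primitive \<Rightarrow> bool" where
  "two_asset_amm X Y \<longleftrightarrow>
     (\<exists>y_out :: state \<Rightarrow> real \<Rightarrow> real.
        \<forall>x y dx. dx \<ge> 0 \<longrightarrow> X (x, y) dx = (x + dx, y - y_out (x, y) dx)) \<and>
     (\<exists>x_out :: state \<Rightarrow> real \<Rightarrow> real.
        \<forall>x y dy. dy \<ge> 0 \<longrightarrow> Y (x, y) dy = (x - x_out (x, y) dy, y + dy))"

definition adjacent :: "swap_primitive \<Rightarrow> swap_primitive \<Rightarrow> state \<Rightarrow> state \<Rightarrow> bool" where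
  "adjacent X Y s t \<longleftrightarrow>
     (\<exists>\<delta>\<ge>0. t = X s \<delta> \<or> t = Y s \<delta> \<or> s = X t \<delta> \<or> s = Y t \<delta>)"

text \<open>The intermediate states of a chain range over all of \<open>\<real>\<^sup>2\<close>, not only over the valid states.\<close>

definition orbit_rel :: "swap_primitive \<Rightarrow> swap_primitive \<Rightarrow> state \<Rightarrow> state \<Rightarrow> bool" where
  "orbit_rel X Y = (adjacent X Y)\<^sup>*\<^sup>*"

definition trading_orbit :: "swap_primitive \<Rightarrow> swap_primitive \<Rightarrow> state \<Rightarrow> state set" where
  "trading_orbit X Y s = {t \<in> valid_states. orbit_rel X Y t s}"

definition validity_invariant :: "swap_primitive \<Rightarrow> swap_primitive \<Rightarrow> bool" where
  "validity_invariant X Y \<longleftrightarrow>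
     (\<forall>s. \<forall>dx\<ge>0. X s dx \<in> valid_states \<longleftrightarrow> s \<in> valid_states) \<and>
     (\<forall>s. \<forall>dy\<ge>0. Y s dy \<in> valid_states \<longleftrightarrow> s \<in> valid_states)"

definition dominates :: "state \<Rightarrow> state \<Rightarrow> bool" where
  "dominates t s \<longleftrightarrow> fst t \<ge> fst s \<and> snd t \<ge> snd s"

definition pareto_efficient :: "swap_primitive \<Rightarrow> swap_primitive \<Rightarrow> bool" where
  "pareto_efficient X Y \<longleftrightarrow>
     (\<forall>s\<in>valid_states. \<forall>t\<in>valid_states. orbit_rel X Y s t \<and> dominates t s \<longrightarrow> t = s)"

definition rescale :: "real \<Rightarrow> real \<Rightarrow> state \<Rightarrow> state" where
  "rescale a b = (\<lambda>(x, y). (a * x, b * y))"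

definition unit_invariant :: "swap_primitive \<Rightarrow> swap_primitive \<Rightarrow> bool" where
  "unit_invariant X Y \<longleftrightarrow>
     (\<forall>a>0. \<forall>b>0. \<forall>s\<in>valid_states.
        (\<forall>dx\<ge>0. X (rescale a b s) (a * dx) = rescale a b (X s dx)) \<and>
        (\<forall>dy\<ge>0. Y (rescale a b s) (b * dy) = rescale a b (Y s dy)))"

definition relabeling_symmetric :: "swap_primitive \<Rightarrow> swap_primitive \<Rightarrow> bool" where
  "relabeling_symmetric X Y \<longleftrightarrow>
     (\<forall>s\<in>valid_states. \<forall>t\<in>valid_states.
        orbit_rel X Y s t \<longleftrightarrow> orbit_rel X Y (prod.swap s) (prod.swap t))"

definition weighted_product :: "real \<Rightarrow> state \<Rightarrow> real" where
  "weighted_product w = (\<lambda>(x, y). x powr w * y powr (1 - w))"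

text \<open>Equality of two families of subsets of the valid states; the levels are the values attained
  there, so that the empty set is not counted as a level set.\<close>

definition orbits_are_level_sets :: "swap_primitive \<Rightarrow> swap_primitive \<Rightarrow> (state \<Rightarrow> real) \<Rightarrow> bool" where
  "orbits_are_level_sets X Y f \<longleftrightarrow>
     trading_orbit X Y ` valid_states =
       (\<lambda>c. {t \<in> valid_states. f t = c}) ` (f ` valid_states)"

end

(* If (x,y) ~ (u,v), rescaling by (y,x) gives (xy,xy) ~ (uy,vx), while rescaling the
   relabeled pair (y,x) ~ (v,u) by (u,v) gives (uy,vx) ~ (uv,uv). So two states on the diagonal
   lie on one orbit, and Pareto efficiency forces xy = uv. Conversely a single X swap reaches
   every larger x-reserve, so each orbit is the whole hyperbola xy = const, a level set of
   sqrt(xy). The equivalence (1,1) ~ (2,1/2) then excludes every weight but 1/2. *)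
theory Submission
  imports Defs
begin

lemma orbit_rel_trans:
  "orbit_rel X Y r s \<Longrightarrow> orbit_rel X Y s t \<Longrightarrow> orbit_rel X Y r t"
  unfolding orbit_rel_def by (rule rtranclp_trans)

lemma orbit_rel_sym:
  assumes "orbit_rel X Y s t"
  shows "orbit_rel X Y t s"
proof -
  have "symp (adjacent X Y)"
    by (rule sympI) (auto simp: adjacent_def)
  then show ?thesis
    using assms unfolding orbit_rel_def by (metis symp_rtranclp sympD)
qed

text \<open>Chains may run through all of the plane, whereas unit invariance speaks only of valid
  states. This lets validity pass along each link in either direction.\<close>

lemma adjacent_valid_iff:
  assumes "validity_invariant X Y" "adjacent X Y s t"
  shows "s \<in> valid_states \<longleftrightarrow> t \<in> valid_states"
  using assms unfolding validity_invariant_def adjacent_def by metis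

text \<open>The amount \<delta> of the link becomes \<open>a * \<delta>\<close> for an
  \<open>X\<close> swap and \<open>b * \<delta>\<close> for a \<open>Y\<close> swap. Both ends are
  assumed valid because the swap may start at either one.\<close>

lemma rescale_adjacent:
  assumes "unit_invariant X Y" "a > 0" "b > 0" "s \<in> valid_states" "t \<in> valid_states"
    and "adjacent X Y s t"
  shows "adjacent X Y (rescale a b s) (rescale a b t)"
proof -
  obtain \<delta> where "\<delta> \<ge> 0" and \<delta>: "t = X s \<delta> \<or> t = Y s \<delta> \<or> s = X t \<delta> \<or> s = Y t \<delta>"
    using assms(6) unfolding adjacent_def by blast
  have "X (rescale a b r) (a * \<delta>) = rescale a b (X r \<delta>)"
    and "Y (rescale a b r) (b * \<delta>) = rescale a b (Y r \<delta>)" if "r \<in> valid_states" for r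
    using assms(1-3) that \<open>\<delta> \<ge> 0\<close> unfolding unit_invariant_def by auto
  moreover have "a * \<delta> \<ge> 0" "b * \<delta> \<ge> 0"
    using assms \<open>\<delta> \<ge> 0\<close> by auto
  ultimately show ?thesis
    using \<delta> assms(4,5) unfolding adjacent_def by metis
qed

lemma rescale_orbit_rel:
  assumes "validity_invariant X Y" "unit_invariant X Y" "a > 0" "b > 0"
    and "s \<in> valid_states" "orbit_rel X Y s t"
  shows "orbit_rel X Y (rescale a b s) (rescale a b t)"
proof -
  have "(adjacent X Y)\<^sup>*\<^sup>* s t"
    using assms(6) by (simp add: orbit_rel_def)
  \<comment> \<open>The induction carries validity of the current end of the chain, which rescaling
    the next link requires.\<close>
  then have "t \<in> valid_states \<and> (adjacent X Y)\<^sup>*\<^sup>* (rescale a b s) (rescale a b t)"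
  proof induction
    case base
    show ?case using assms(5) by simp
  next
    case (step t u)
    then have "u \<in> valid_states"
      using adjacent_valid_iff[OF assms(1)] by blast
    then show ?case
      using step rescale_adjacent[OF assms(2-4)] by (meson rtranclp.rtrancl_into_rtrancl)
  qed
  then show ?thesis by (simp add: orbit_rel_def)
qed

lemma orbit_rel_imp_product_eq:
  assumes "validity_invariant X Y" "pareto_efficient X Y" "unit_invariant X Y"
    and "relabeling_symmetric X Y"
    and valid: "(x, y) \<in> valid_states" "(u, v) \<in> valid_states"
    and orbit: "orbit_rel X Y (x, y) (u, v)"
  shows "x * y = u * v"
proof -
  have pos: "x > 0" "y > 0" "u > 0" "v > 0"
    using valid by (auto simp: valid_states_def)
  have "orbit_rel X Y (y, x) (v, u)"
    using assms(4) valid orbit unfolding relabeling_symmetric_def by fastforce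
  moreover have "(y, x) \<in> valid_states"
    using pos by (simp add: valid_states_def)
  ultimately have "orbit_rel X Y (u * y, v * x) (u * v, v * u)"
    using rescale_orbit_rel[OF assms(1,3) pos(3,4)] by (fastforce simp: rescale_def)
  moreover have "orbit_rel X Y (y * x, x * y) (y * u, x * v)"
    using rescale_orbit_rel[OF assms(1,3) pos(2,1) valid(1) orbit] by (simp add: rescale_def)
  ultimately have diag: "orbit_rel X Y (x * y, x * y) (u * v, u * v)"
    using orbit_rel_trans by (metis mult.commute)
  \<comment> \<open>Two diagonal states are always comparable under \<open>dominates\<close>, so
    Pareto efficiency applies to them; symmetry of the orbit relation covers the other
    order.\<close>
  have diag_unique: "q = p"
    if "orbit_rel X Y (p, p) (q, q)" "p \<le> q" "p > 0" for p q
  proof -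
    have "(p, p) \<in> valid_states" "(q, q) \<in> valid_states" "dominates (q, q) (p, p)"
      using that by (auto simp: valid_states_def dominates_def)
    then show ?thesis
      using assms(2) that(1) unfolding pareto_efficient_def by fastforce
  qed
  have "x * y > 0" "u * v > 0"
    using pos by auto
  then show ?thesis
    using diag_unique diag orbit_rel_sym[OF diag] linear by metis
qed

text \<open>The converse comes from one swap: its x-reserve can be prescribed, and the product law
  already proved then fixes its y-reserve.\<close>

lemma orbit_rel_iff_product_eq:
  assumes "two_asset_amm X Y" "validity_invariant X Y" "pareto_efficient X Y"
    and "unit_invariant X Y" "relabeling_symmetric X Y"
    and "(x, y) \<in> valid_states" "(u, v) \<in> valid_states"
  shows "orbit_rel X Y (x, y) (u, v) \<longleftrightarrow> x * y = u * v"
proof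
  show "orbit_rel X Y (x, y) (u, v) \<Longrightarrow> x * y = u * v"
    using orbit_rel_imp_product_eq assms by blast
next
  have reach: "orbit_rel X Y (x, y) (u, v)"
    if valid: "(x, y) \<in> valid_states" "(u, v) \<in> valid_states" and eq: "x * y = u * v"
      and "x \<le> u" for x y u v
  proof -
    obtain v' where v': "X (x, y) (u - x) = (u, v')"
      using assms(1) \<open>x \<le> u\<close> unfolding two_asset_amm_def by fastforce
    have "(u, v') \<in> valid_states"
      using assms(2) valid(1) v' \<open>x \<le> u\<close> unfolding validity_invariant_def
      by (metis diff_ge_0_iff_ge)
    moreover have adj: "adjacent X Y (x, y) (u, v')"
      using v' \<open>x \<le> u\<close> unfolding adjacent_def by (metis diff_ge_0_iff_ge)
    then have "orbit_rel X Y (x, y) (u, v')"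
      by (simp add: orbit_rel_def)
    moreover have "u > 0"
      using valid by (simp add: valid_states_def)
    \<comment> \<open>The product law gives \<open>x * y = u * v'\<close>, hence
      \<open>u * v = u * v'\<close>, and cancelling \<open>u\<close> yields
      \<open>v' = v\<close>.\<close>
    ultimately show ?thesis
      using orbit_rel_imp_product_eq[OF assms(2-5) valid(1)] eq by fastforce
  qed
  assume "x * y = u * v"
  \<comment> \<open>An \<open>X\<close> swap only raises the x-reserve, so for
    \<open>u \<le> x\<close> the swap starts at \<open>(u, v)\<close> and the relation is
    reversed.\<close>
  then show "orbit_rel X Y (x, y) (u, v)"
    using reach[of x y u v] orbit_rel_sym[OF reach[of u v x y]] assms(6,7) by linarith
qed

text \<open>An orbit equal to some level set must have level \<open>f s\<close>, since it contains
  \<open>s\<close> itself. Thus equality of the two families can be tested on pairs of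
  states.\<close>

lemma orbits_are_level_sets_iff:
  "orbits_are_level_sets X Y f \<longleftrightarrow>
     (\<forall>s\<in>valid_states. \<forall>t\<in>valid_states. orbit_rel X Y t s \<longleftrightarrow> f t = f s)"
proof
  assume level: "orbits_are_level_sets X Y f"
  show "\<forall>s\<in>valid_states. \<forall>t\<in>valid_states. orbit_rel X Y t s \<longleftrightarrow> f t = f s"
  proof (intro ballI)
    fix s t assume "s \<in> valid_states" "t \<in> valid_states"
    moreover obtain c where "trading_orbit X Y s = {t \<in> valid_states. f t = c}"
      using level \<open>s \<in> valid_states\<close> unfolding orbits_are_level_sets_def by blast
    moreover have "s \<in> trading_orbit X Y s"
      using \<open>s \<in> valid_states\<close> by (simp add: trading_orbit_def orbit_rel_def)
    ultimately show "orbit_rel X Y t s \<longleftrightarrow> f t = f s"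
      by (auto simp: trading_orbit_def)
  qed
next
  assume "\<forall>s\<in>valid_states. \<forall>t\<in>valid_states. orbit_rel X Y t s \<longleftrightarrow> f t = f s"
  then have "trading_orbit X Y s = {t \<in> valid_states. f t = f s}" if "s \<in> valid_states" for s
    using that by (auto simp: trading_orbit_def)
  then show "orbits_are_level_sets X Y f"
    by (simp add: orbits_are_level_sets_def image_image)
qed

theorem corollary2p11:
  fixes X Y :: "real \<times> real \<Rightarrow> real \<Rightarrow> real \<times> real"
  assumes "two_asset_amm X Y"
    and "validity_invariant X Y"
    and "pareto_efficient X Y"
    and "unit_invariant X Y"
    and "relabeling_symmetric X Y"
  shows "(\<exists>w::real. 0 < w \<and> w < 1 \<and> orbits_are_level_sets X Y (weighted_product w)) \<and>
    (\<forall>w::real. 0 < w \<and> w < 1 \<and> orbits_are_level_sets X Y (weighted_product w) \<longrightarrow>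
       w = 1 / 2 \<and>
       (\<forall>s\<in>valid_states. \<exists>k. \<forall>(x, y)\<in>trading_orbit X Y s. x * y = k))"
proof -
  note orbit_iff = orbit_rel_iff_product_eq[OF assms]
  show ?thesis
  proof (intro conjI allI impI)
    have "weighted_product (1 / 2) (x, y) = sqrt (x * y)" if "(x, y) \<in> valid_states" for x y
      using that by (simp add: weighted_product_def valid_states_def powr_half_sqrt real_sqrt_mult)
    then have "orbits_are_level_sets X Y (weighted_product (1 / 2))"
      unfolding orbits_are_level_sets_iff by (auto simp: orbit_iff)
    then show "\<exists>w::real. 0 < w \<and> w < 1 \<and> orbits_are_level_sets X Y (weighted_product w)"
      by (intro exI[of _ "1 / 2"]) simp
  next
    fix w :: real
    assume w: "0 < w \<and> w < 1 \<and> orbits_are_level_sets X Y (weighted_product w)"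
    have "(2, 1 / 2) \<in> valid_states" "(1, 1) \<in> valid_states"
      by (simp_all add: valid_states_def)
    moreover from this have "orbit_rel X Y (2, 1 / 2) (1, 1)"
      by (simp add: orbit_iff)
    ultimately have "weighted_product w (2, 1 / 2) = weighted_product w (1, 1)"
      using w unfolding orbits_are_level_sets_iff by blast
    \<comment> \<open>The left value is \<open>2 powr w / 2 powr (1 - w)\<close> and the right value
      is 1.\<close>
    then have "2 powr w = 2 powr (1 - w)"
      by (simp add: weighted_product_def powr_divide)
    then have "w = 1 - w"
      by (subst (asm) powr_inj) simp_all
    then show "w = 1 / 2"
      by simp
  next
    \<comment> \<open>Here \<open>k\<close> is the product of the reserves of \<open>s\<close>; the
      weight does not enter.\<close>
    show "\<forall>s\<in>valid_states. \<exists>k. \<forall>(x, y)\<in>trading_orbit X Y s. x * y = k"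
      using orbit_rel_imp_product_eq[OF assms(2-5)] by (fastforce simp: trading_orbit_def)
  qed
qed

end
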